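(* Let $G=(V,E)$ be a directed graph with leader set $V_L\subseteq V$ and target set $V_T\subseteq V$. If $(G;V_L;V_T)$ is targeted controllable with respect to $\mathcal{Q}_d(G)$, then $V_L\cup(V\setminus V_T)$ is a zero forcing set in $G$.
   Context: All graphs are finite, simple, directed and without self-loops; $V=\{1,\dots,n\}$. Distance: $d(u,v)$ is the length of a shortest directed path from $u$ to $v$ in $G$ ($\infty$ if there is none, $0$ if $u=v$). Zero forcing: given a directed graph whose vertices are colored black or white, the color-change rule is: if $u$ is black and exactly one out-neighbour $v$ of $u$ is white, then change the color of $v$ to black. For a set $C$ of vertices, color $C$ black and all other vertices white; the derived set $D(C)$ is the set of black vertices obtained by applying the rule until no more changes are possible. A set $Z$ is a zero forcing set if $D(Z)$ is the whole vertex set. Qualitative class: $\mathcal{Q}(G)=\{X\in\mathbb{R}^{n\times n} : \text{for } i\neq j,\ X_{ij}\neq 0\iff (j,i)\in E\}$ (diagonal entries are arbitrary). A matrix $X\in\mathcal{Q}(G)$ is distance-information preserving if for any two distinct vertices $i,j\in V$, $d(j,i)=k$ (with $k$ finite) implies $(X^k)_{ij}\neq0$. $\mathcal{Q}_d(G)\subseteq\mathcal{Q}(G)$ is the set of all distance-information preserving matrices in $\mathcal{Q}(G)$. Target control: for $V'=\{v_1,\dots,v_r\}\subseteq V$, $P(V;V')$ is the $n\times r$ matrix with $P_{ij}=1$ if $i=v_j$ and $P_{ij}=0$ otherwise. Put $U=P(V;V_L)$, $H=P^T(V;V_T)$, $p=|V_T|$. For a class $\mathcal{Q}_s(G)\subseteq\mathcal{Q}(G)$,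 $(G;V_L;V_T)$ is targeted controllable with respect to $\mathcal{Q}_s(G)$ if for every $X\in\mathcal{Q}_s(G)$ the system $\dot x=Xx+Uu$, $y=Hx$ is output controllable, i.e. $\operatorname{rank}\begin{pmatrix}HU&HXU&\cdots&HX^{n-1}U\end{pmatrix}=p$. *)

theory Defs
  imports
    "Graph_Theory.Graph_Theory"
    "Jordan_Normal_Form.DL_Rank"
    "HOL-Library.Extended_Nat"
begin

text \<open>
  Vertices are 0-based, \<open>V = {0..<n}\<close>, to agree with the index ranges of
  \<^typ>\<open>real mat\<close>.  Finite simple loop-free digraphs are \<^const>\<open>pair_digraph\<close>s.
\<close>

definition digraph_dist :: "'a pair_pre_digraph \<Rightarrow> 'a \<Rightarrow> 'a \<Rightarrow> enat" where
  "digraph_dist G u v =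
     (INF p \<in> {p. pre_digraph.apath (with_proj G) u p v}. enat (length p))"


text \<open>Colorings are represented by their sets of black vertices.\<close>

definition color_change :: "'a pair_pre_digraph \<Rightarrow> 'a set \<Rightarrow> 'a set \<Rightarrow> bool" where
  "color_change G B B' \<longleftrightarrow>
     (\<exists>u\<in>B. \<exists>v. {w. (u, w) \<in> parcs G} - B = {v} \<and> B' = insert v B)"

text \<open>The description is justified by the lemma \<open>derived_set_unique\<close> below.\<close>

definition derived_set :: "'a pair_pre_digraph \<Rightarrow> 'a set \<Rightarrow> 'a set" where
  "derived_set G C = (THE D. (color_change G)\<^sup>*\<^sup>* C D \<and> (\<nexists>D'. color_change G D D'))"

definition zero_forcing_set :: "'a pair_pre_digraph \<Rightarrow> 'a set \<Rightarrow> bool" where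
  "zero_forcing_set G Z \<longleftrightarrow> Z \<subseteq> pverts G \<and> derived_set G Z = pverts G"

lemma color_change_closed_superset:
  assumes "(color_change G)\<^sup>*\<^sup>* C D" "C \<subseteq> E" "\<nexists>E'. color_change G E E'"
  shows "D \<subseteq> E"
  using assms(1)
proof (induction rule: rtranclp_induct)
  case base
  show ?case by (rule assms(2))
next
  case (step B B')
  then obtain u v where uv: "u \<in> B" "{w. (u, w) \<in> parcs G} - B = {v}" "B' = insert v B"
    by (auto simp: color_change_def)
  have "v \<in> E"
  proof (rule ccontr)
    assume "v \<notin> E"
    with uv step.IH have "u \<in> E" "{w. (u, w) \<in> parcs G} - E = {v}"
      by blast+
    then have "color_change G E (insert v E)"
      unfolding color_change_def by blast
    with assms(3) show False by blast
  qed
  with uv(3) step.IH show ?case by blast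
qed

lemma color_change_terminates:
  assumes "pair_digraph G" "C \<subseteq> pverts G"
  shows "\<exists>D. (color_change G)\<^sup>*\<^sup>* C D \<and> (\<nexists>D'. color_change G D D')"
  using assms(2)
proof (induction "card (pverts G - C)" arbitrary: C rule: less_induct)
  case less
  interpret pair_digraph G by (rule assms(1))
  show ?case
  proof (cases "\<exists>C'. color_change G C C'")
    case True
    then obtain C' where C': "color_change G C C'" by blast
    then obtain u v where uv: "{w. (u, w) \<in> parcs G} - C = {v}" "C' = insert v C"
      by (auto simp: color_change_def)
    then have "(u, v) \<in> parcs G" "v \<notin> C" by blast+
    then have v: "v \<in> pverts G - C" by (auto dest: in_arcsD2)
    have "pverts G - C' \<subset> pverts G - C" using v uv(2) by blast
    then have "card (pverts G - C') < card (pverts G - C)"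
      by (intro psubset_card_mono) (simp_all add: pair_finite_verts)
    moreover have "C' \<subseteq> pverts G" using less.prems v uv(2) by blast
    ultimately obtain D where "(color_change G)\<^sup>*\<^sup>* C' D" "\<nexists>D'. color_change G D D'"
      using less.hyps by blast
    with C' show ?thesis by (meson converse_rtranclp_into_rtranclp)
  qed blast
qed

lemma derived_set_unique:
  assumes "pair_digraph G" "C \<subseteq> pverts G"
  shows "\<exists>!D. (color_change G)\<^sup>*\<^sup>* C D \<and> (\<nexists>D'. color_change G D D')"
proof -
  have sub: "C \<subseteq> D" if "(color_change G)\<^sup>*\<^sup>* C D" for D
    using that by (induction rule: rtranclp_induct) (auto simp: color_change_def)
  show ?thesis
  proof (rule ex_ex1I)
    fix D E
    assume "(color_change G)\<^sup>*\<^sup>* C D \<and> (\<nexists>D'. color_change G D D')"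
      and "(color_change G)\<^sup>*\<^sup>* C E \<and> (\<nexists>E'. color_change G E E')"
    then show "D = E"
      using sub color_change_closed_superset[of G C D E] color_change_closed_superset[of G C E D]
      by blast
  qed (rule color_change_terminates[OF assms])
qed


text \<open>Entry \<open>(i, j)\<close> of a matrix belongs to the arc from \<open>j\<close> to \<open>i\<close>.\<close>

definition qualitative_class :: "nat \<Rightarrow> nat pair_pre_digraph \<Rightarrow> real mat set" where
  "qualitative_class n G =
     {X \<in> carrier_mat n n.
        \<forall>i<n. \<forall>j<n. i \<noteq> j \<longrightarrow> (X $$ (i, j) \<noteq> 0 \<longleftrightarrow> (j, i) \<in> parcs G)}"

definition distance_preserving_class :: "nat \<Rightarrow> nat pair_pre_digraph \<Rightarrow> real mat set" where
  "distance_preserving_class n G =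
     {X \<in> qualitative_class n G.
        \<forall>i<n. \<forall>j<n. i \<noteq> j \<longrightarrow>
          (\<forall>k::nat. digraph_dist G j i = enat k \<longrightarrow> (X ^\<^sub>m k) $$ (i, j) \<noteq> 0)}"

text \<open>
  The columns of the selection matrix \<open>P(V; S)\<close> follow the increasing enumeration of \<open>S\<close>.
\<close>

definition selection_mat :: "nat \<Rightarrow> nat set \<Rightarrow> real mat" where
  "selection_mat n S =
     mat n (card S) (\<lambda>(i, j). if i = sorted_list_of_set S ! j then 1 else 0)"

text \<open>The block row matrix \<open>(HU  HXU  \<dots>  HX\<^sup>n\<^sup>-\<^sup>1U)\<close>.\<close>

definition output_controllability_mat ::
    "nat \<Rightarrow> real mat \<Rightarrow> real mat \<Rightarrow> real mat \<Rightarrow> real mat" where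
  "output_controllability_mat n X U H =
     mat_of_cols (dim_row H) (concat (map (\<lambda>k. cols (H * X ^\<^sub>m k * U)) [0..<n]))"

text \<open>
  \<^const>\<open>vec_space.rank\<close> takes the number of rows as its first argument.
\<close>

definition output_controllable :: "nat \<Rightarrow> real mat \<Rightarrow> real mat \<Rightarrow> real mat \<Rightarrow> bool" where
  "output_controllable n X U H \<longleftrightarrow>
     vec_space.rank (dim_row H) (output_controllability_mat n X U H) = dim_row H"

definition targeted_controllable ::
    "nat \<Rightarrow> nat set \<Rightarrow> nat set \<Rightarrow> real mat set \<Rightarrow> bool" where
  "targeted_controllable n V\<^sub>L V\<^sub>T Q \<longleftrightarrow>
     (\<forall>X\<in>Q. output_controllable n X (selection_mat n V\<^sub>L) (transpose_mat (selection_mat n V\<^sub>T)))"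

end

theory Submission
  imports Defs
begin

text \<open>
  Let \<open>D\<close> be the derived set and suppose that \<open>S = V - D\<close> is nonempty.  Then \<open>S \<subseteq> V\<^sub>T - V\<^sub>L\<close>, and
  every vertex of \<open>D\<close> has either no or at least two out-neighbours in \<open>S\<close>.  If \<open>X\<close> is a matrix
  supported on the arcs of \<open>G\<close> and the diagonal whose columns all sum to \<open>0\<close> over \<open>S\<close>, then the indicator vector
  of \<open>S\<close> annihilates \<open>X\<^sup>kU\<close> for all \<open>k\<close>, and the system is not output controllable.  These matrices
  form a linear space.  On this space each condition of distance preservation is satisfied by some
  matrix: put weight \<open>1\<close> along a shortest path and repair the column sum at each of its
  vertices, on the diagonal for vertices in \<open>S\<close> and with a second out-neighbour in \<open>S\<close> otherwise.
  The repairs create no new walk of the same length between the ends, because the path is shortest.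
  As the conditions are nonvanishing conditions for polynomials, they can be satisfied
  simultaneously; this is seen by moving along lines.
\<close>

section \<open>Rank and left null vectors\<close>

text \<open>A maximal linearly independent set of columns has \<open>rank A = n\<close> elements, so
  by counting dimensions it is a basis of the whole space.\<close>

lemma (in vec_space) rank_eq_dim_imp_span:
  assumes A: "A \<in> carrier_mat n nc" and r: "rank A = n"
  shows "span (set (cols A)) = carrier_vec n"
proof -
  have cA: "set (cols A) \<subseteq> carrier_vec n" using A cols_dim by blast
  obtain S where S: "maximal S (\<lambda>T. T \<subseteq> set (cols A) \<and> lin_indpt T)"
    using maximal_exists[of "(\<lambda>T. T \<subseteq> set (cols A) \<and> lin_indpt T)" "card (set (cols A))" "{}"]
    by (meson List.finite_set card_mono empty_iff empty_subsetI finite_lin_indpt2 rev_finite_subset)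
  have card: "card S = n" using rank_card_indpt[OF A S] r by simp
  have S2: "S \<subseteq> set (cols A)" "lin_indpt S" using S by (auto simp: maximal_def)
  have "basis S"
    by (rule dim_li_is_basis)
      (use S2 cA card in \<open>auto simp: dim_is_n intro: finite_subset\<close>)
  then have "span S = carrier_vec n" by (auto simp: basis_def)
  moreover have "span S \<subseteq> span (set (cols A))" using S2(1) by (rule span_is_monotone)
  moreover have "span (set (cols A)) \<subseteq> carrier_vec n" using cA span_is_subset2 by auto
  ultimately show ?thesis by auto
qed

text \<open>With full row rank the columns would span everything, making \<open>w\<close> orthogonal
  to itself; over the reals this forces \<open>w = 0\<close>.\<close>

lemma rank_neq_of_left_null_vec:
  fixes A :: "real mat"
  assumes A: "A \<in> carrier_mat p nc" and w: "w \<in> carrier_vec p" "w \<noteq> 0\<^sub>v p"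
    and orth: "\<And>c. c \<in> set (cols A) \<Longrightarrow> w \<bullet> c = 0"
  shows "vec_space.rank p A \<noteq> p"
proof
  interpret vec_space "TYPE(real)" p .
  assume "rank A = p"
  then have sp: "span (set (cols A)) = carrier_vec p" using rank_eq_dim_imp_span[OF A] by simp
  have cA: "set (cols A) \<subseteq> carrier_vec p" using A cols_dim by blast
  have "w \<in> orthogonal_complement (set (cols A))"
    using w orth by (auto simp: orthogonal_complement_def)
  then have "w \<in> orthogonal_complement (carrier_vec p)"
    using in_orthogonal_complement_span[OF cA] sp by simp
  then have "w \<bullet> w = 0" using w by (auto simp: orthogonal_complement_def)
  then show False using w conjugate_square_eq_0_vec[OF w(1)] by simp
qed

text \<open>Each induction step absorbs the rightmost factor \<open>X\<close> into \<open>y\<close>,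
  hence the arbitrary \<open>y\<close>; the last factor left is transposed onto \<open>z\<close>.
  The exponent starts at one because the scalar product of \<open>z\<close> with \<open>y\<close>
  itself need not vanish.\<close>

lemma left_null_vec_pow_mat:
  fixes X :: "real mat"
  assumes X: "X \<in> carrier_mat n n" and z: "z \<in> carrier_vec n"
    and null: "transpose_mat X *\<^sub>v z = 0\<^sub>v n" and y: "y \<in> carrier_vec n"
  shows "z \<bullet> ((X ^\<^sub>m Suc k) *\<^sub>v y) = 0"
  using y
proof (induction k arbitrary: y)
  case 0
  have "z \<bullet> (X *\<^sub>v y) = (transpose_mat X *\<^sub>v z) \<bullet> y"
    using transpose_vec_mult_scalar[OF X 0 z] by simp
  then show ?case using null 0 X by simp
next
  case (Suc k)
  have "X ^\<^sub>m Suc (Suc k) *\<^sub>v y = X ^\<^sub>m Suc k *\<^sub>v (X *\<^sub>v y)"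
    using Suc.prems X by (subst pow_mat.simps(2), subst assoc_mult_mat_vec) (auto simp del: pow_mat.simps)
  then show ?case using Suc X by (auto simp del: pow_mat.simps)
qed

lemma selection_mat_carrier [simp]: "selection_mat n S \<in> carrier_mat n (card S)"
  by (simp add: selection_mat_def)

text \<open>Passes from output coordinates, indexed by positions in the enumeration of
  \<open>T\<close>, to state coordinates, indexed by vertices. It evaluates the transposed output
  matrix at the left null vector used below.\<close>

lemma selection_mat_mult_indicator:
  assumes S: "S \<subseteq> T" and T: "T \<subseteq> {0..<n}"
  shows "selection_mat n T *\<^sub>v vec (card T) (\<lambda>r. of_bool (sorted_list_of_set T ! r \<in> S))
         = vec n (\<lambda>i. of_bool (i \<in> S))"
proof (rule eq_vecI)
  fix i assume "i < dim_vec (vec n (\<lambda>i. of_bool (i \<in> S)) :: real vec)"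
  then have i: "i < n" by simp
  have fin: "finite T" using T finite_subset by blast
  let ?l = "sorted_list_of_set T"
  have len: "length ?l = card T" and dist: "distinct ?l" and set: "set ?l = T"
    using fin by auto
  have "bij_betw ((!) ?l) {0..<card T} T"
    using bij_betw_nth[OF dist] len set by (metis atLeast0LessThan)
  then have "(\<Sum>r=0..<card T. (if i = ?l ! r then 1 else 0) * of_bool (?l ! r \<in> S))
      = (\<Sum>t\<in>T. (if i = t then 1 else 0) * of_bool (t \<in> S) :: real)"
    by (rule sum.reindex_bij_betw)
  also have "\<dots> = (\<Sum>t\<in>T. if t = i then of_bool (i \<in> S) else 0)"
    by (intro sum.cong) auto
  also have "\<dots> = of_bool (i \<in> S)" using fin S by auto
  finally show "(selection_mat n T *\<^sub>v vec (card T) (\<lambda>r. of_bool (?l ! r \<in> S))) $ i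
      = vec n (\<lambda>i. of_bool (i \<in> S)) $ i"
    using i by (simp add: selection_mat_def scalar_prod_def row_def)
qed (simp add: selection_mat_def)

text \<open>The indicator \<open>w\<close> of \<open>S\<close> in output coordinates annihilates
  every column of every block \<open>H X^k U\<close>. Moving \<open>H\<close> across the scalar
  product replaces \<open>w\<close> by the indicator \<open>z\<close> in state coordinates. For
  \<open>k = 0\<close> the product vanishes because \<open>S\<close> contains no leader, for
  \<open>k > 0\<close> because the column sums make \<open>z\<close> a left null vector of
  \<open>X\<close>.\<close>

lemma not_output_controllable:
  assumes X: "X \<in> carrier_mat n n"
    and S: "S \<noteq> {}" "S \<subseteq> T" "S \<inter> L = {}" and T: "T \<subseteq> {0..<n}" and L: "L \<subseteq> {0..<n}"
    and sums: "\<And>u. u < n \<Longrightarrow> (\<Sum>a\<in>S. X $$ (a, u)) = 0"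
  shows "\<not> output_controllable n X (selection_mat n L) (transpose_mat (selection_mat n T))"
proof -
  let ?U = "selection_mat n L" and ?H = "transpose_mat (selection_mat n T)"
  define p where "p = card T"
  define w :: "real vec" where "w = vec p (\<lambda>r. of_bool (sorted_list_of_set T ! r \<in> S))"
  define z :: "real vec" where "z = vec n (\<lambda>i. of_bool (i \<in> S))"
  have fin: "finite T" "finite L" using T L finite_subset by blast+
  have w: "w \<in> carrier_vec p" and z: "z \<in> carrier_vec n" by (auto simp: w_def z_def)
  have H: "?H \<in> carrier_mat p n" and HT: "transpose_mat ?H *\<^sub>v w = z"
    using selection_mat_mult_indicator[OF S(2) T] by (auto simp: p_def w_def z_def)
  have wn: "w \<noteq> 0\<^sub>v p"
  proof
    assume "w = 0\<^sub>v p"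
    then have "z = 0\<^sub>v n" using HT by (auto intro!: eq_vecI simp: p_def selection_mat_def scalar_prod_def)
    moreover obtain i where "i \<in> S" "i < n" using S T by fastforce
    moreover from this have "z $ i = 1" by (simp add: z_def)
    ultimately have "(0 :: real) = 1" by simp
    then show False by simp
  qed
  have Sn: "S \<subseteq> {0..<n}" using S T by auto
  have null: "transpose_mat X *\<^sub>v z = 0\<^sub>v n"
  proof (rule eq_vecI)
    fix u assume "u < dim_vec (0\<^sub>v n :: real vec)"
    then have u: "u < n" by simp
    have "(\<Sum>a = 0..<n. X $$ (a, u) * of_bool (a \<in> S)) = (\<Sum>a\<in>S. X $$ (a, u))"
      using Sn by (intro sum.mono_neutral_cong_right) auto
    then show "(transpose_mat X *\<^sub>v z) $ u = 0\<^sub>v n $ u"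
      using u X sums by (auto simp: scalar_prod_def z_def)
  qed (use X in auto)
  have key: "w \<bullet> c = 0" if k: "c \<in> set (cols (?H * X ^\<^sub>m k * ?U))" for c k
  proof -
    have XU: "X ^\<^sub>m k * ?U \<in> carrier_mat n (card L)"
      by (rule mult_carrier_mat[OF pow_carrier_mat[OF X] selection_mat_carrier])
    have HXU: "?H * X ^\<^sub>m k * ?U = ?H * (X ^\<^sub>m k * ?U)"
      using assoc_mult_mat[OF H, of "X ^\<^sub>m k" n ?U "card L"] X by simp
    obtain j where j: "j < card L" and c: "c = col (?H * (X ^\<^sub>m k * ?U)) j"
      using k XU unfolding HXU cols_def by (auto simp: selection_mat_def)
    have uj: "col ?U j \<in> carrier_vec n"
      by (metis carrier_matD(1) col_carrier_vec col_dim selection_mat_carrier)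
    have "c = ?H *\<^sub>v ((X ^\<^sub>m k) *\<^sub>v col ?U j)"
      unfolding c using j X by (subst col_mult2[OF H XU j], subst col_mult2[of _ n n _ "card L"]) auto
    then have "w \<bullet> c = (transpose_mat ?H *\<^sub>v w) \<bullet> ((X ^\<^sub>m k) *\<^sub>v col ?U j)"
      using transpose_vec_mult_scalar[OF H _ w, of "(X ^\<^sub>m k) *\<^sub>v col ?U j"] X uj
      by (metis mult_mat_vec_carrier pow_carrier_mat)
    then have wc: "w \<bullet> c = z \<bullet> ((X ^\<^sub>m k) *\<^sub>v col ?U j)" using HT by simp
    show ?thesis
    proof (cases k)
      case 0
      \<comment> \<open>Column \<open>j\<close> of \<open>U\<close> is the unit vector of a leader,
        where \<open>z\<close> vanishes.\<close>
      have "sorted_list_of_set L ! j \<in> L"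
        using j fin by (metis nth_mem set_sorted_list_of_set length_sorted_list_of_set)
      then have "sorted_list_of_set L ! j \<notin> S" using S by auto
      then have "z \<bullet> col ?U j = 0"
        using j by (auto simp: scalar_prod_def z_def selection_mat_def intro!: sum.neutral)
      then show ?thesis using wc 0 X uj by simp
    next
      case (Suc k')
      then show ?thesis using left_null_vec_pow_mat[OF X z null uj, of k'] wc by simp
    qed
  qed
  define cs where "cs = concat (map (\<lambda>k. cols (?H * X ^\<^sub>m k * ?U)) [0..<n])"
  have dr: "dim_row ?H = p" using H by auto
  have "set (cols (?H * X ^\<^sub>m k * ?U)) \<subseteq> carrier_vec p" for k
    using cols_dim[of "?H * X ^\<^sub>m k * ?U"] dr by simp
  then have "set cs \<subseteq> carrier_vec p" unfolding cs_def by auto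
  then have cols: "cols (mat_of_cols p cs) = cs" by simp
  have orth: "w \<bullet> c = 0" if "c \<in> set cs" for c
    using that key by (auto simp: cs_def)
  have "vec_space.rank p (mat_of_cols p cs) \<noteq> p"
    by (rule rank_neq_of_left_null_vec[OF mat_of_cols_carrier(1) w wn])
      (use orth in \<open>simp add: cols\<close>)
  then show ?thesis
    unfolding output_controllable_def output_controllability_mat_def dr cs_def by simp
qed

section \<open>Genericity along lines\<close>

text \<open>Join a point \<open>A\<close> that is good for \<open>F\<close> to a point
  \<open>B\<close> that is good for \<open>f\<close>. On the line each condition becomes a nonzero
  univariate polynomial in \<open>t\<close>, so only finitely many parameters are bad. Working along
  lines avoids multivariate polynomials.\<close>

lemma simultaneous_nonvanishing:
  fixes g :: "'f \<Rightarrow> 'a \<Rightarrow> real" and line :: "'a \<Rightarrow> 'a \<Rightarrow> real \<Rightarrow> 'a"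
  assumes "finite F" and "W \<noteq> {}"
    and line: "\<And>A B t. A \<in> W \<Longrightarrow> B \<in> W \<Longrightarrow> line A B t \<in> W"
      "\<And>A B. A \<in> W \<Longrightarrow> B \<in> W \<Longrightarrow> line A B 0 = A"
      "\<And>A B. A \<in> W \<Longrightarrow> B \<in> W \<Longrightarrow> line A B 1 = B"
    and poly: "\<And>f A B. f \<in> F \<Longrightarrow> A \<in> W \<Longrightarrow> B \<in> W \<Longrightarrow> \<exists>q. \<forall>t. g f (line A B t) = poly q t"
    and ex: "\<And>f. f \<in> F \<Longrightarrow> \<exists>A\<in>W. g f A \<noteq> 0"
  shows "\<exists>A\<in>W. \<forall>f\<in>F. g f A \<noteq> 0"
  using \<open>finite F\<close> poly ex
proof (induction F rule: finite_induct)
  case empty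
  then show ?case using \<open>W \<noteq> {}\<close> by auto
next
  case (insert f F)
  then obtain A where A: "A \<in> W" "\<And>f. f \<in> F \<Longrightarrow> g f A \<noteq> 0" by (metis insertCI)
  obtain B where B: "B \<in> W" "g f B \<noteq> 0" using insert.prems(2) by blast
  have "\<forall>h\<in>insert f F. \<exists>q. \<forall>t. g h (line A B t) = poly q t"
    using insert.prems(1) A(1) B(1) by blast
  then obtain q where q: "\<And>h t. h \<in> insert f F \<Longrightarrow> g h (line A B t) = poly (q h) t"
    by metis
  \<comment> \<open>The value at \<open>t = 0\<close> is nonzero for the old conditions, the value
    at \<open>t = 1\<close> for the new one.\<close>
  have "q h \<noteq> 0" if "h \<in> insert f F" for h
    using that q[OF that, of 0] q[OF that, of 1] A B line(2,3)[OF A(1) B(1)] by auto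
  then have "finite (\<Union>h\<in>insert f F. {t. poly (q h) t = 0})"
    using insert.hyps(1) poly_roots_finite by blast
  then obtain t where "t \<notin> (\<Union>h\<in>insert f F. {t. poly (q h) t = 0})"
    using ex_new_if_finite[OF infinite_UNIV_char_0] by blast
  then have "\<forall>h\<in>insert f F. g h (line A B t) \<noteq> 0" using q by auto
  then show ?case using line(1)[OF A(1) B(1)] by blast
qed

definition mat_line :: "nat \<Rightarrow> real mat \<Rightarrow> real mat \<Rightarrow> real \<Rightarrow> real mat" where
  "mat_line n A B t = mat n n (\<lambda>(i, j). A $$ (i, j) + t * (B $$ (i, j) - A $$ (i, j)))"

lemma mat_line_pow_poly:
  assumes "i < n" "j < n"
  shows "\<exists>q. \<forall>t. (mat_line n A B t ^\<^sub>m k) $$ (i, j) = poly q t"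
  using assms
proof (induction k arbitrary: i j)
  case 0
  have "(mat_line n A B t ^\<^sub>m 0) $$ (i, j) = poly [:of_bool (i = j):] t" for t
    using 0 by (simp add: mat_line_def)
  then show ?case by blast
next
  case (Suc k)
  then have "\<forall>a\<in>{0..<n}. \<exists>q. \<forall>t. (mat_line n A B t ^\<^sub>m k) $$ (i, a) = poly q t" by simp
  then obtain q where q: "\<And>a t. a < n \<Longrightarrow> (mat_line n A B t ^\<^sub>m k) $$ (i, a) = poly (q a) t"
    by (metis atLeastLessThan_iff zero_le)
  have "(mat_line n A B t ^\<^sub>m Suc k) $$ (i, j)
      = poly (\<Sum>a=0..<n. q a * [:A $$ (a, j), B $$ (a, j) - A $$ (a, j):]) t" for t
  proof -
    have L: "mat_line n A B t \<in> carrier_mat n n" by (simp add: mat_line_def)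
    then have "(mat_line n A B t ^\<^sub>m Suc k) $$ (i, j)
        = (\<Sum>a=0..<n. (mat_line n A B t ^\<^sub>m k) $$ (i, a) * mat_line n A B t $$ (a, j))"
      using Suc.prems pow_carrier_mat[OF L, of k] by (auto simp: scalar_prod_def)
    also have "\<dots> = (\<Sum>a=0..<n. poly (q a) t * (A $$ (a, j) + t * (B $$ (a, j) - A $$ (a, j))))"
      using q Suc.prems by (intro sum.cong) (auto simp: mat_line_def)
    also have "\<dots> = poly (\<Sum>a=0..<n. q a * [:A $$ (a, j), B $$ (a, j) - A $$ (a, j):]) t"
      unfolding poly_sum by (intro sum.cong) (simp_all add: algebra_simps)
    finally show ?thesis .
  qed
  then show ?case by blast
qed

section \<open>Shortest paths\<close>

text \<open>Translates distances into relation powers, which match powers of matrices. The minimum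
  is taken over paths in the definition but extends to walks, since every walk contains a path of no
  greater length between its ends.\<close>

lemma digraph_dist_eq_enatD:
  assumes "pair_wf_digraph G" and d: "digraph_dist G u v = enat k"
  shows "(u, v) \<in> parcs G ^^ k" and "\<And>m. (u, v) \<in> parcs G ^^ m \<Longrightarrow> u \<in> pverts G \<Longrightarrow> k \<le> m"
proof -
  interpret pair_wf_digraph G by fact
  have awalk_relpow: "(a, b) \<in> parcs G ^^ length p" if "awalk a p b" for a b p
    using that
  proof (induction p arbitrary: a)
    case (Cons e p)
    then show ?case
      by (cases e) (auto simp: awalk_Cons_iff simp del: relpow.simps intro: relpow_Suc_I2)
  qed (auto simp: awalk_def)
  have relpow_awalk: "\<exists>p. awalk a p b \<and> length p = m" if "(a, b) \<in> parcs G ^^ m" "a \<in> pverts G" for a b m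
    using that
  proof (induction m arbitrary: a)
    case 0
    then show ?case by (auto simp: awalk_def intro!: exI[of _ "[]"])
  next
    case (Suc m)
    then obtain c where c: "(a, c) \<in> parcs G" "(c, b) \<in> parcs G ^^ m" by (metis relpow_Suc_D2)
    then obtain p where "awalk c p b" "length p = m" using Suc.IH[of c] in_arcsD2 by auto
    then show ?case using c by (intro exI[of _ "(a, c) # p"]) (auto simp: awalk_Cons_iff)
  qed
  let ?L = "(\<lambda>p. enat (length p)) ` {p. apath u p v}"
  have inf: "Inf ?L = enat k" using d by (simp add: digraph_dist_def)
  \<comment> \<open>The infimum of the empty set is infinite, so a path exists; in
    \<open>enat\<close> the infimum of a nonempty set is attained.\<close>
  then have "?L \<noteq> {}" by (metis Inf_empty enat.distinct(1) top_enat_def)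
  then have "Inf ?L \<in> ?L" by (metis Inf_enat_def LeastI_ex ex_in_conv)
  then obtain p where p: "apath u p v" "length p = k" using inf by auto
  then show "(u, v) \<in> parcs G ^^ k" using awalk_relpow by (auto simp: apath_def)
  fix m assume "(u, v) \<in> parcs G ^^ m" "u \<in> pverts G"
  then obtain q where q: "awalk u q v" "length q = m" using relpow_awalk by blast
  \<comment> \<open>With unit costs the cost of a walk is its length and no cycle is
    negative.\<close>
  have "awalk_cost (\<lambda>_. 1) (awalk_to_apath q) \<le> awalk_cost (\<lambda>_. 1) q"
    by (rule awalk_to_path_no_neg_cyc_cost[OF q(1)]) (auto simp: awalk_cost_def sum_list_triv not_less)
  then have "length (awalk_to_apath q) \<le> m" using q by (simp add: awalk_cost_def sum_list_triv)
  moreover have "enat k \<le> enat (length (awalk_to_apath q))"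
    unfolding inf[symmetric] using apath_awalk_to_apath[OF q(1)] by (intro Inf_lower) auto
  ultimately show "k \<le> m" by simp
qed

text \<open>Replacing the segment from \<open>f a\<close> to \<open>f b\<close> by a shorter walk
  would contradict minimality. A replacement of length 0 rules out repeated vertices, one of length
  1 rules out forward chords. Backward arcs may exist.\<close>

lemma shortest_path_vertices:
  assumes walk: "(u, v) \<in> R ^^ k" and min: "\<And>m. (u, v) \<in> R ^^ m \<Longrightarrow> k \<le> m"
  obtains f where "f 0 = u" "f k = v" "\<And>m. m < k \<Longrightarrow> (f m, f (Suc m)) \<in> R"
    "inj_on f {..k}" "\<And>a b. Suc a < b \<Longrightarrow> b \<le> k \<Longrightarrow> (f a, f b) \<notin> R"
proof -
  obtain f where f: "f 0 = u" "f k = v" "\<And>m. m < k \<Longrightarrow> (f m, f (Suc m)) \<in> R"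
    using walk unfolding relpow_fun_conv by blast
  have seg: "(f a, f (a + b)) \<in> R ^^ b" if "a + b \<le> k" for a b
    using that f(3) unfolding relpow_fun_conv by (intro exI[of _ "\<lambda>i. f (a + i)"]) auto
  have short: False if ab: "a \<le> b" "b \<le> k" and s: "(f a, f b) \<in> R ^^ s" "s < b - a" for a b s
  proof -
    have "(f 0, f a) \<in> R ^^ a" "(f b, f k) \<in> R ^^ (k - b)"
      using seg[of 0 a] seg[of b "k - b"] ab by auto
    then have "(u, v) \<in> R ^^ (a + s + (k - b))"
      using s(1) f(1,2) unfolding relpow_add by blast
    then show False using min[of "a + s + (k - b)"] ab s(2) by linarith
  qed
  have "a = b" if "a \<le> b" "b \<le> k" "f a = f b" for a b
    using short[of a b 0] that by fastforce
  then have "inj_on f {..k}" by (intro inj_onI) (metis atMost_iff nle_le)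
  moreover have "(f a, f b) \<notin> R" if "Suc a < b" "b \<le> k" for a b
    using short[of a b 1] that by (auto simp: less_diff_conv)
  ultimately show thesis using that f by blast
qed

section \<open>Matrices with vanishing column sums\<close>

text \<open>Unlike in \<open>qualitative_class\<close>, entries at arcs may vanish, so that the
  class is a linear space. The sum condition says that the indicator vector of \<open>S\<close> is a
  left null vector.\<close>

definition zero_sum_class :: "nat \<Rightarrow> (nat \<times> nat) set \<Rightarrow> nat set \<Rightarrow> real mat set" where
  "zero_sum_class n E S =
     {X \<in> carrier_mat n n.
        (\<forall>i<n. \<forall>j<n. i \<noteq> j \<and> (j, i) \<notin> E \<longrightarrow> X $$ (i, j) = 0) \<and>
        (\<forall>u<n. (\<Sum>a\<in>S. X $$ (a, u)) = 0)}"

lemma mat_line_zero_sum_class: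
  assumes "A \<in> zero_sum_class n E S" "B \<in> zero_sum_class n E S" and S: "S \<subseteq> {0..<n}"
  shows "mat_line n A B t \<in> zero_sum_class n E S"
proof -
  have "(\<Sum>a\<in>S. mat_line n A B t $$ (a, u)) = 0" if u: "u < n" for u
  proof -
    have "(\<Sum>a\<in>S. mat_line n A B t $$ (a, u))
        = (\<Sum>a\<in>S. A $$ (a, u) + t * (B $$ (a, u) - A $$ (a, u)))"
      using S u by (intro sum.cong) (auto simp: mat_line_def)
    also have "\<dots> = (\<Sum>a\<in>S. A $$ (a, u)) + t * ((\<Sum>a\<in>S. B $$ (a, u)) - (\<Sum>a\<in>S. A $$ (a, u)))"
      by (simp add: sum.distrib sum_subtractf flip: sum_distrib_left)
    finally show ?thesis using assms u by (simp add: zero_sum_class_def)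
  qed
  then show ?thesis using assms by (auto simp: zero_sum_class_def mat_line_def)
qed

text \<open>The entry of the power is the weighted count of walks of length \<open>k\<close> from
  \<open>j\<close> to \<open>i\<close>. In the matrix built here a repair entry never advances along
  the path, so a walk using one cannot arrive in time and only the path itself, of weight 1, is
  counted.\<close>

lemma zero_sum_class_path_matrix:
  assumes E: "E \<subseteq> {0..<n} \<times> {0..<n}" and S: "S \<subseteq> {0..<n}"
    and stalled: "\<And>u v. u < n \<Longrightarrow> u \<notin> S \<Longrightarrow> {w. (u, w) \<in> E} \<inter> S \<noteq> {v}"
    and i: "i < n" and j: "j < n"
    and walk: "(j, i) \<in> E ^^ k" and min: "\<And>m. (j, i) \<in> E ^^ m \<Longrightarrow> k \<le> m"
  shows "\<exists>X \<in> zero_sum_class n E S. (X ^\<^sub>m k) $$ (i, j) \<noteq> 0"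
proof -
  obtain f where f: "f 0 = j" "f k = i" and fE: "\<And>m. m < k \<Longrightarrow> (f m, f (Suc m)) \<in> E"
    and inj: "inj_on f {..k}" and chord: "\<And>a b. Suc a < b \<Longrightarrow> b \<le> k \<Longrightarrow> (f a, f b) \<notin> E"
    using shortest_path_vertices[OF walk min] by blast
  have fn: "f m < n" if "m \<le> k" for m
    using that fE[of m] f(2) i E by (cases "m = k") auto
  \<comment> \<open>\<open>x\<close> is the row of the repair in column \<open>f m\<close>. The
    choice \<open>x = f m\<close> is the diagonal repair if \<open>f m\<close> lies in
    \<open>S\<close>, and a mere placeholder if \<open>f (Suc m)\<close> lies outside
    \<open>S\<close>. In the remaining case stalling supplies a second out-neighbour in
    \<open>S\<close>.\<close>
  have "\<exists>x. (f (Suc m) \<in> S \<longrightarrow> x \<in> S) \<and> x \<noteq> f (Suc m) \<and> (x = f m \<or> (f m, x) \<in> E)" if m: "m < k" for m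
  proof (cases "f m \<in> S \<or> f (Suc m) \<notin> S")
    case True
    moreover have "f m \<noteq> f (Suc m)" using inj_onD[OF inj, of m "Suc m"] m by auto
    ultimately show ?thesis by blast
  next
    case False
    then have "{w. (f m, w) \<in> E} \<inter> S \<noteq> {f (Suc m)}" using stalled fn m by simp
    then show ?thesis using False fE[OF m] by blast
  qed
  then obtain x where x: "\<And>m. m < k \<Longrightarrow> f (Suc m) \<in> S \<Longrightarrow> x m \<in> S"
      "\<And>m. m < k \<Longrightarrow> x m \<noteq> f (Suc m)" "\<And>m. m < k \<Longrightarrow> x m = f m \<or> (f m, x m) \<in> E"
    by metis
  have xn: "x m < n" if "m < k" for m using x(3)[OF that] fn[of m] that E by auto
  \<comment> \<open>The factor \<open>s m\<close> switches the repair off when the path arc leaves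
    the column sum over \<open>S\<close> at zero.\<close>
  define s :: "nat \<Rightarrow> real" where "s m = of_bool (f (Suc m) \<in> S)" for m
  define X where "X = mat n n (\<lambda>(a, u). \<Sum>m<k. if u = f m
      then of_bool (a = f (Suc m)) - s m * of_bool (a = x m) else 0)"
  have Xc: "X \<in> carrier_mat n n" by (simp add: X_def)
  have finS: "finite S" using S finite_subset by blast
  have "X \<in> zero_sum_class n E S"
    unfolding zero_sum_class_def
  proof (intro CollectI conjI allI impI Xc)
    fix a u assume "a < n" "u < n" "a \<noteq> u \<and> (u, a) \<notin> E"
    then show "X $$ (a, u) = 0"
      using fE x(3) by (fastforce simp: X_def intro!: sum.neutral)
  next
    fix u assume u: "u < n"
    have "(\<Sum>a\<in>S. X $$ (a, u)) = (\<Sum>a\<in>S. \<Sum>m<k. if u = f m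
        then of_bool (a = f (Suc m)) - s m * of_bool (a = x m) else 0)"
      using S u by (intro sum.cong) (auto simp: X_def)
    also have "\<dots> = (\<Sum>m<k. \<Sum>a\<in>S. if u = f m
        then of_bool (a = f (Suc m)) - s m * of_bool (a = x m) else 0)"
      by (rule sum.swap)
    also have "\<dots> = 0"
    proof (rule sum.neutral, rule ballI)
      fix m assume m: "m \<in> {..<k}"
      have "(\<Sum>a\<in>S. of_bool (a = f (Suc m)) - s m * of_bool (a = x m))
          = of_bool (f (Suc m) \<in> S) - s m * of_bool (x m \<in> S)"
        using finS by (simp add: sum_subtractf sum_distrib_left[symmetric] of_bool_def)
      moreover have "s m * of_bool (x m \<in> S) = of_bool (f (Suc m) \<in> S)"
        using x(1)[of m] m by (auto simp: s_def)
      ultimately show "(\<Sum>a\<in>S. if u = f m then of_bool (a = f (Suc m)) - s m * of_bool (a = x m) else 0) = 0"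
        by (cases "u = f m") simp_all
    qed
    finally show "(\<Sum>a\<in>S. X $$ (a, u)) = 0" .
  qed
  moreover have "(X ^\<^sub>m k) $$ (i, j) = 1"
  proof -
    \<comment> \<open>Splitting off the first arc of a walk from \<open>u\<close>: it is either a
      path arc or a repair.\<close>
    have step: "(X ^\<^sub>m Suc m) $$ (i, u) = (\<Sum>l<k. if u = f l
        then (X ^\<^sub>m m) $$ (i, f (Suc l)) - s l * (X ^\<^sub>m m) $$ (i, x l) else 0)"
      if u: "u < n" for m u
    proof -
      have "(X ^\<^sub>m Suc m) $$ (i, u) = (\<Sum>a=0..<n. (X ^\<^sub>m m) $$ (i, a) * X $$ (a, u))"
        using u i Xc pow_carrier_mat[OF Xc, of m] by (auto simp: scalar_prod_def)
      also have "\<dots> = (\<Sum>a=0..<n. \<Sum>l<k. if u = f l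
          then (X ^\<^sub>m m) $$ (i, a) * (of_bool (a = f (Suc l)) - s l * of_bool (a = x l)) else 0)"
        using u by (intro sum.cong) (auto simp: X_def sum_distrib_left if_distrib cong: if_cong)
      also have "\<dots> = (\<Sum>l<k. \<Sum>a=0..<n. if u = f l
          then (X ^\<^sub>m m) $$ (i, a) * (of_bool (a = f (Suc l)) - s l * of_bool (a = x l)) else 0)"
        by (rule sum.swap)
      also have "\<dots> = (\<Sum>l<k. if u = f l
          then (X ^\<^sub>m m) $$ (i, f (Suc l)) - s l * (X ^\<^sub>m m) $$ (i, x l) else 0)"
      proof (intro sum.cong refl)
        fix l assume l: "l \<in> {..<k}"
        have "(\<Sum>a=0..<n. (X ^\<^sub>m m) $$ (i, a) * (of_bool (a = f (Suc l)) - s l * of_bool (a = x l)))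
            = (\<Sum>a=0..<n. (if a = f (Suc l) then (X ^\<^sub>m m) $$ (i, a) else 0)
                - (if a = x l then s l * (X ^\<^sub>m m) $$ (i, a) else 0))"
          by (intro sum.cong) (auto simp: algebra_simps)
        also have "\<dots> = (X ^\<^sub>m m) $$ (i, f (Suc l)) - s l * (X ^\<^sub>m m) $$ (i, x l)"
          using fn[of "Suc l"] xn[of l] l by (simp add: sum_subtractf)
        finally show "(\<Sum>a=0..<n. if u = f l
            then (X ^\<^sub>m m) $$ (i, a) * (of_bool (a = f (Suc l)) - s l * of_bool (a = x l)) else 0)
          = (if u = f l then (X ^\<^sub>m m) $$ (i, f (Suc l)) - s l * (X ^\<^sub>m m) $$ (i, x l) else 0)"
          by simp
      qed
      finally show ?thesis .
    qed
    \<comment> \<open>A repair never moves forward: \<open>f (Suc l)\<close> is excluded by the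
      choice of \<open>x\<close>, later path vertices by the absence of chords and by
      injectivity.\<close>
    have off: "x l \<notin> f ` {Suc l..k}" if l: "l < k" for l
    proof
      assume "x l \<in> f ` {Suc l..k}"
      then obtain b where b: "x l = f b" "Suc l \<le> b" "b \<le> k" by auto
      have "b \<noteq> Suc l" using x(2)[OF l] b by auto
      then have "Suc l < b" using b by simp
      then have "(f l, f b) \<notin> E" "f b \<noteq> f l"
        using chord b inj_onD[OF inj, of b l] l by auto
      then show False using x(3)[OF l] b by auto
    qed
    \<comment> \<open>Within \<open>m\<close> steps \<open>i\<close> is reachable only from the last
      \<open>m + 1\<close> path vertices, and from the farthest of them only along the path. Nothing
      is claimed about the values at the nearer ones, where repairs may contribute. The case
      \<open>m = k\<close> gives the entry at \<open>f 0 = j\<close>.\<close>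
    have "(\<forall>w<n. w \<notin> f ` {k - m..k} \<longrightarrow> (X ^\<^sub>m m) $$ (i, w) = 0) \<and> (X ^\<^sub>m m) $$ (i, f (k - m)) = 1"
      if "m \<le> k" for m
      using that
    proof (induction m)
      case 0
      then show ?case using i Xc f(2) by auto
    next
      case (Suc m)
      then have m: "m < k" and zero: "\<And>w. w < n \<Longrightarrow> w \<notin> f ` {k - m..k} \<Longrightarrow> (X ^\<^sub>m m) $$ (i, w) = 0"
        and one: "(X ^\<^sub>m m) $$ (i, f (k - m)) = 1" by auto
      have corr: "(X ^\<^sub>m m) $$ (i, x l) = 0" if l: "l < k - m" for l
      proof (rule zero)
        show "x l < n" using xn l by simp
        have "{k - m..k} \<subseteq> {Suc l..k}" using l by auto
        then show "x l \<notin> f ` {k - m..k}" using off[of l] l by auto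
      qed
      have "(X ^\<^sub>m Suc m) $$ (i, w) = 0" if w: "w < n" "w \<notin> f ` {k - Suc m..k}" for w
        unfolding step[OF w(1)]
      proof (rule sum.neutral, rule ballI)
        fix l assume l: "l \<in> {..<k}"
        have "(X ^\<^sub>m m) $$ (i, f (Suc l)) - s l * (X ^\<^sub>m m) $$ (i, x l) = 0" if "w = f l"
        proof -
          have l': "Suc l < k - m" using w(2) that l
            by (metis Suc_diff_Suc atLeastAtMost_iff imageI lessThan_iff less_imp_le_nat m not_le
                less_Suc_eq_le Suc_less_eq)
          then have "f (Suc l) \<notin> f ` {k - m..k}"
            using inj_onD[OF inj] by fastforce
          then have "(X ^\<^sub>m m) $$ (i, f (Suc l)) = 0" using zero fn[of "Suc l"] l by simp
          then show ?thesis using corr[of l] l' by simp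
        qed
        then show "(if w = f l then (X ^\<^sub>m m) $$ (i, f (Suc l)) - s l * (X ^\<^sub>m m) $$ (i, x l) else 0) = 0"
          by simp
      qed
      moreover have "(X ^\<^sub>m Suc m) $$ (i, f (k - Suc m)) = 1"
      proof -
        let ?l = "k - Suc m"
        have l: "?l < k" "Suc ?l = k - m" using m by auto
        \<comment> \<open>Injectivity leaves a single summand; its path arc contributes 1 by
          induction and its repair 0 by \<open>corr\<close>.\<close>
        have "(X ^\<^sub>m Suc m) $$ (i, f ?l) = (\<Sum>l<k. if l = ?l
            then (X ^\<^sub>m m) $$ (i, f (Suc l)) - s l * (X ^\<^sub>m m) $$ (i, x l) else 0)"
          unfolding step[OF fn[of ?l, simplified]]
          by (intro sum.cong) (use inj_onD[OF inj] in auto)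
        also have "\<dots> = (X ^\<^sub>m m) $$ (i, f (Suc ?l)) - s ?l * (X ^\<^sub>m m) $$ (i, x ?l)"
          using l by simp
        also have "\<dots> = 1" using l one corr[of ?l] by simp
        finally show ?thesis .
      qed
      ultimately show ?case by blast
    qed
    from this[of k] show ?thesis using f(1) by simp
  qed
  ultimately show ?thesis by (intro bexI[of _ X]) auto
qed

text \<open>Path matrices satisfy the distance conditions one at a time, and genericity along lines
  inside \<open>zero_sum_class\<close> satisfies them together.\<close>

lemma ex_distance_preserving_zero_sum:
  assumes G: "pair_digraph G" and V: "pverts G = {0..<n}" and S: "S \<subseteq> {0..<n}"
    and stalled: "\<And>u v. u < n \<Longrightarrow> u \<notin> S \<Longrightarrow> {w. (u, w) \<in> parcs G} \<inter> S \<noteq> {v}"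
  shows "\<exists>X \<in> distance_preserving_class n G. \<forall>u<n. (\<Sum>a\<in>S. X $$ (a, u)) = 0"
proof -
  interpret pair_digraph G by (rule G)
  let ?E = "parcs G"
  let ?W = "zero_sum_class n ?E S"
  define F where "F = {(i, j, k). i < n \<and> j < n \<and> i \<noteq> j \<and> digraph_dist G j i = enat k}"
  define g where "g = (\<lambda>(i, j, k) X. (X ^\<^sub>m k) $$ (i, j) :: real)"
  have E: "?E \<subseteq> {0..<n} \<times> {0..<n}" using V in_arcsD1 in_arcsD2 by auto
  \<comment> \<open>The length \<open>k\<close> is determined by \<open>i\<close> and
    \<open>j\<close>, so there are finitely many conditions.\<close>
  have "F \<subseteq> (\<lambda>(i, j). (i, j, the_enat (digraph_dist G j i))) ` ({0..<n} \<times> {0..<n})"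
    by (force simp: F_def image_iff)
  then have finF: "finite F" by (rule finite_subset) auto
  have "0\<^sub>m n n \<in> ?W" using S by (auto simp: zero_sum_class_def intro!: sum.neutral)
  then have W: "?W \<noteq> {}" by blast
  have "\<exists>X\<in>?W. \<forall>h\<in>F. g h X \<noteq> 0"
  proof (rule simultaneous_nonvanishing[OF finF W, where line = "mat_line n"])
    fix h assume "h \<in> F"
    then obtain i j k where h: "h = (i, j, k)" "i < n" "j < n" "digraph_dist G j i = enat k"
      by (auto simp: F_def)
    show "\<exists>q. \<forall>t. g h (mat_line n A B t) = poly q t" for A B
      using mat_line_pow_poly[OF h(2,3)] by (simp add: g_def h(1))
    show "\<exists>A\<in>?W. g h A \<noteq> 0"
      using zero_sum_class_path_matrix[OF E S stalled h(2,3)]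
        digraph_dist_eq_enatD[OF pair_wf_digraph_axioms h(4)] h V by (auto simp: g_def)
  next
    fix A B t assume AB: "A \<in> ?W" "B \<in> ?W"
    then show "mat_line n A B t \<in> ?W" by (rule mat_line_zero_sum_class[OF _ _ S])
    show "mat_line n A B 0 = A" "mat_line n A B 1 = B"
      using AB by (auto simp: mat_line_def zero_sum_class_def)
  qed
  then obtain X where X: "X \<in> ?W" and nz: "\<And>i j k. (i, j, k) \<in> F \<Longrightarrow> (X ^\<^sub>m k) $$ (i, j) \<noteq> 0"
    unfolding g_def by fastforce
  \<comment> \<open>The nonzero pattern comes from the distance conditions: an arc joins vertices at
    distance exactly 1, and the condition for \<open>k = 1\<close> concerns the entry
    itself.\<close>
  have "X $$ (i, j) \<noteq> 0" if ij: "i < n" "j < n" "i \<noteq> j" "(j, i) \<in> ?E" for i j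
  proof -
    have "apath j [(j, i)] i" using ij V by (auto simp: apath_def awalk_def)
    then have "digraph_dist G j i \<le> enat (length [(j, i)])"
      unfolding digraph_dist_def by (intro INF_lower) simp
    then obtain k where k: "digraph_dist G j i = enat k" "k \<le> 1"
      by (cases "digraph_dist G j i") auto
    moreover have "k \<noteq> 0" using digraph_dist_eq_enatD(1)[OF pair_wf_digraph_axioms k(1)] ij(3) by (cases k) auto
    ultimately have "(X ^\<^sub>m 1) $$ (i, j) \<noteq> 0" using nz[of i j 1] ij by (auto simp: F_def)
    then show ?thesis using X by (simp add: zero_sum_class_def)
  qed
  then have "X \<in> qualitative_class n G"
    using X by (auto simp: qualitative_class_def zero_sum_class_def)
  then have "X \<in> distance_preserving_class n G"
    using nz by (auto simp: distance_preserving_class_def F_def)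
  then show ?thesis using X by (auto simp: zero_sum_class_def)
qed

section \<open>Zero forcing\<close>

lemma derived_set_properties:
  assumes G: "pair_digraph G" and C: "C \<subseteq> pverts G"
  shows "C \<subseteq> derived_set G C" "derived_set G C \<subseteq> pverts G" "\<nexists>D'. color_change G (derived_set G C) D'"
proof -
  interpret pair_digraph G by (rule G)
  let ?D = "derived_set G C"
  have D: "(color_change G)\<^sup>*\<^sup>* C ?D \<and> (\<nexists>D'. color_change G ?D D')"
    unfolding derived_set_def by (rule theI'[OF derived_set_unique[OF G C]])
  then show "\<nexists>D'. color_change G ?D D'" by blast
  from D have "(color_change G)\<^sup>*\<^sup>* C ?D" by blast
  then show "C \<subseteq> ?D" by (induction rule: rtranclp_induct) (auto simp: color_change_def)
  \<comment> \<open>The full vertex set admits no further change, so it bounds the derived set from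
    above.\<close>
  have "\<nexists>D'. color_change G (pverts G) D'"
    unfolding color_change_def using in_arcsD2 by blast
  with D C show "?D \<subseteq> pverts G" using color_change_closed_superset by blast
qed

theorem theorem11:
  fixes n :: nat and G :: "nat pair_pre_digraph" and V\<^sub>L V\<^sub>T :: "nat set"
  assumes "pair_digraph G"
    and "pverts G = {0..<n}"
    and "V\<^sub>L \<subseteq> pverts G"
    and "V\<^sub>T \<subseteq> pverts G"
    and "targeted_controllable n V\<^sub>L V\<^sub>T (distance_preserving_class n G)"
  shows "zero_forcing_set G (V\<^sub>L \<union> (pverts G - V\<^sub>T))"
proof (rule ccontr)
  interpret pair_digraph G by (rule assms(1))
  let ?Z = "V\<^sub>L \<union> (pverts G - V\<^sub>T)"
  define D where "D = derived_set G ?Z"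
  define S where "S = pverts G - D"
  have Z: "?Z \<subseteq> pverts G" using assms(3) by auto
  note D = derived_set_properties[OF assms(1) Z, folded D_def]
  assume "\<not> zero_forcing_set G ?Z"
  then have "S \<noteq> {}" using Z D(2) by (auto simp: zero_forcing_set_def D_def S_def)
  \<comment> \<open>All leaders and all non-targets are black in \<open>D\<close>, so the white
    vertices are targets that are not leaders.\<close>
  have S: "S \<subseteq> V\<^sub>T" "S \<inter> V\<^sub>L = {}" "S \<subseteq> {0..<n}" using D(1) assms(2) by (auto simp: S_def)
  have stalled: "{w. (u, w) \<in> parcs G} \<inter> S \<noteq> {v}" if "u < n" "u \<notin> S" for u v
  proof
    assume "{w. (u, w) \<in> parcs G} \<inter> S = {v}"
    \<comment> \<open>Arcs end in vertices of \<open>G\<close>, so the out-neighbours in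
      \<open>S\<close> are exactly the white ones; a unique one could be forced by
      \<open>u\<close>.\<close>
    moreover have "{w. (u, w) \<in> parcs G} \<inter> S = {w. (u, w) \<in> parcs G} - D"
      using in_arcsD2 by (auto simp: S_def)
    moreover have "u \<in> D" using that assms(2) by (auto simp: S_def)
    ultimately have "color_change G D (insert v D)" by (auto simp: color_change_def)
    then show False using D(3) by blast
  qed
  obtain X where X: "X \<in> distance_preserving_class n G" and sums: "\<And>u. u < n \<Longrightarrow> (\<Sum>a\<in>S. X $$ (a, u)) = 0"
    using ex_distance_preserving_zero_sum[OF assms(1,2) S(3) stalled] by blast
  have "X \<in> carrier_mat n n"
    using X by (simp add: distance_preserving_class_def qualitative_class_def)
  then have "\<not> output_controllable n X (selection_mat n V\<^sub>L) (transpose_mat (selection_mat n V\<^sub>T))"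
    using not_output_controllable \<open>S \<noteq> {}\<close> S sums assms(2-4) by metis
  then show False using assms(5) X by (simp add: targeted_controllable_def)
qed

end
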